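(* Let $n\ge 3$, $1\le t<n$, and let $c_1,c_2,\ldots,c_t\in[n]$ be distinct integers such that the sequence $(c_1,\ldots,c_t)$ avoids the pattern $231$. If $c_i<c_j$ for some $1\le i<j\le t$ and there exists $\alpha\in[n]$ with $\alpha<c_i$ and $\alpha\notin\{c_1,\ldots,c_t\}$ (for that same $i$), then $|S_{n,(c_1,\ldots,c_t)}(231)|=0$; otherwise, $$|S_{n,(c_1,\ldots,c_t)}(231)|=\prod_{k=1}^{t+1}C_{c_{(k)}-c_{(k-1)}-1},$$ where $C_i=\frac{1}{i+1}\binom{2i}{i}$ is the $i$th Catalan number, $c_{(0)}=0$, $c_{(t+1)}=n+1$, and $c_{(1)}<c_{(2)}<\cdots<c_{(t)}$ are the elements of $\{c_1,\ldots,c_t\}$ listed in increasing order.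
   Context: $[n]=\{1,\ldots,n\}$ and $S_n$ is the set of permutations of $[n]$ written as sequences $(\tau(1),\ldots,\tau(n))$. A sequence of distinct integers $\tau=(\tau(1),\ldots,\tau(m))$ contains $\sigma\in S_k$ as a pattern if there are indices $1\le i_1<\cdots<i_k\le m$ such that for all $1\le a<b\le k$, $\tau(i_a)<\tau(i_b)$ if and only if $\sigma(a)<\sigma(b)$; otherwise $\tau$ avoids $\sigma$. $S_{n,(c_1,\ldots,c_t)}(\sigma_1,\ldots,\sigma_m)$ is the set of $\tau\in S_n$ with $(\tau(1),\ldots,\tau(t))=(c_1,\ldots,c_t)$ that avoid all of $\sigma_1,\ldots,\sigma_m$. *)

theory Defs
  imports Complex_Main "HOL-Library.Sublist" "HOL-Combinatorics.Multiset_Permutations"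
begin

text \<open>Sequences are lists, so positions count from 0, while the values of permutations of \<open>[n]\<close>
  range over \<open>{1..n}\<close>.  The function \<open>f\<close> picks the positions \<open>i\<^sub>1 < \<dots> < i\<^sub>k\<close> of the occurrence.\<close>

definition contains_pattern :: "'a::linorder list \<Rightarrow> nat list \<Rightarrow> bool" where
  "contains_pattern \<tau> \<sigma> \<longleftrightarrow>
     (\<exists>f :: nat \<Rightarrow> nat. strict_mono_on {..<length \<sigma>} f \<and> (\<forall>a<length \<sigma>. f a < length \<tau>) \<and>
        (\<forall>a b. a < b \<and> b < length \<sigma> \<longrightarrow> (\<tau> ! f a < \<tau> ! f b \<longleftrightarrow> \<sigma> ! a < \<sigma> ! b)))"

definition avoids :: "'a::linorder list \<Rightarrow> nat list \<Rightarrow> bool" where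
  "avoids \<tau> \<sigma> \<longleftrightarrow> \<not> contains_pattern \<tau> \<sigma>"

text \<open>The set $S_{n,(c_1,\ldots,c_t)}(\sigma_1,\ldots,\sigma_m)$, with the patterns given as a set.\<close>

definition prefix_avoiders :: "nat \<Rightarrow> nat list \<Rightarrow> nat list set \<Rightarrow> nat list set" where
  "prefix_avoiders n cs \<Sigma> =
     {\<tau> \<in> permutations_of_set {1..n}. prefix cs \<tau> \<and> (\<forall>\<sigma>\<in>\<Sigma>. avoids \<tau> \<sigma>)}"

definition catalan :: "nat \<Rightarrow> real" where
  "catalan i = 1 / (real i + 1) * real ((2 * i) choose i)"

text \<open>The list $c_{(0)}, c_{(1)}, \ldots, c_{(t+1)}$.  When \<open>set cs \<subseteq> {1..n}\<close> it is strictly increasing,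
  so natural-number subtraction does not truncate in $c_{(k)} - c_{(k-1)} - 1$.\<close>

definition bordered_sort :: "nat \<Rightarrow> nat list \<Rightarrow> nat list" where
  "bordered_sort n cs = 0 # sorted_list_of_set (set cs) @ [n + 1]"

end

theory Submission
  imports Defs "HOL-Computational_Algebra.Formal_Power_Series"
begin

text \<open>Write a permutation with prefix \<open>c\<close> as \<open>c w\<close>.  An occurrence of 231 with only the 2 in \<open>c\<close>
  is excluded iff, for every entry \<open>x\<close> of \<open>c\<close>, the letters of \<open>w\<close> below \<open>x\<close> precede those above \<open>x\<close>;
  an occurrence with 2 and 3 in \<open>c\<close> is excluded iff no missing letter lies below an ascending
  pair of \<open>c\<close>.  Hence \<open>w\<close> is a concatenation of arbitrary 231-avoiders of the gaps between the
  sorted entries of \<open>c\<close>, in increasing order.  For a prefix of length one the same decomposition is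
  the Catalan recurrence, which counts the avoiders of a single gap.\<close>

section \<open>Occurrences of 231 by where they are cut\<close>

primrec separates :: "'a::linorder \<Rightarrow> 'a list \<Rightarrow> bool" where
  "separates x [] \<longleftrightarrow> True"
| "separates x (y # w) \<longleftrightarrow> (x < y \<longrightarrow> (\<forall>z\<in>set w. \<not> z < x)) \<and> separates x w"

primrec avoids231 :: "'a::linorder list \<Rightarrow> bool" where
  "avoids231 [] \<longleftrightarrow> True"
| "avoids231 (x # w) \<longleftrightarrow> separates x w \<and> avoids231 w"

text \<open>Counterpart of \<open>separates\<close>, where \<open>x\<close> is the 2 and the list
  must supply 3 and 1: here \<open>z\<close> is the 1, following the list, and the list must supply
  2 and 3.\<close>

primrec no_ascent_above :: "'a::linorder \<Rightarrow> 'a list \<Rightarrow> bool" where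
  "no_ascent_above z [] \<longleftrightarrow> True"
| "no_ascent_above z (x # w) \<longleftrightarrow> (z < x \<longrightarrow> (\<forall>y\<in>set w. \<not> x < y)) \<and> no_ascent_above z w"

lemma separates_append:
  "separates x (u @ v) \<longleftrightarrow>
     separates x u \<and> separates x v \<and> (\<forall>y\<in>set u. \<forall>z\<in>set v. \<not> (z < x \<and> x < y))"
  by (induction u) auto

lemma separates_lower: "\<forall>y\<in>set u. y < x \<Longrightarrow> separates x u"
  by (induction u) auto

lemma separates_upper: "\<forall>y\<in>set u. x < y \<Longrightarrow> separates x u"
  by (induction u) auto

lemma no_ascent_above_lower: "\<forall>y\<in>set u. y < z \<Longrightarrow> no_ascent_above z u"
  by (induction u) auto

text \<open>An occurrence of 231 lies inside \<open>u\<close>, lies inside \<open>v\<close>, is cut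
  after its 2, or is cut after its 3; the four conjuncts exclude these cases in turn.\<close>

lemma avoids231_append:
  "avoids231 (u @ v) \<longleftrightarrow>
     avoids231 u \<and> avoids231 v \<and> (\<forall>x\<in>set u. separates x v) \<and> (\<forall>z\<in>set v. no_ascent_above z u)"
  by (induction u) (auto simp: separates_append)

text \<open>Once a letter above \<open>x\<close> has occurred, no letter below \<open>x\<close> may
  follow; since \<open>x\<close> itself is absent, the two filters lose nothing.\<close>

lemma separates_eq_filter:
  assumes "separates x w" "x \<notin> set w"
  shows "w = filter (\<lambda>y. y < x) w @ filter (\<lambda>y. x < y) w"
  using assms
proof (induction w)
  case (Cons y w)
  show ?case
  proof (cases "y < x")
    case True
    with Cons show ?thesis by auto
  next
    case False
    \<comment> \<open>Now \<open>y\<close> is above \<open>x\<close>, being different from it, so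
      \<open>separates\<close> bars every smaller letter from the tail.\<close>
    with Cons.prems have "filter (\<lambda>y. y < x) w = []" by (auto simp: filter_empty_conv)
    with Cons False show ?thesis by auto
  qed
qed simp

section \<open>Agreement with the positional definition of avoidance\<close>

lemma all_pairs_less_Suc:
  "(\<forall>j k. j < k \<longrightarrow> k < Suc l \<longrightarrow> P j k) \<longleftrightarrow>
     (\<forall>k<l. P 0 (Suc k)) \<and> (\<forall>j k. j < k \<longrightarrow> k < l \<longrightarrow> P (Suc j) (Suc k))"
proof (intro iffI conjI allI impI)
  fix j k
  assume *: "(\<forall>k<l. P 0 (Suc k)) \<and> (\<forall>j k. j < k \<longrightarrow> k < l \<longrightarrow> P (Suc j) (Suc k))"
    and jk: "j < k" "k < Suc l"
  from jk obtain k' where "k = Suc k'" by (cases k) auto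
  with * jk show "P j k" by (cases j) auto
qed auto

lemma separates_iff_nth:
  "separates x w \<longleftrightarrow> (\<forall>j k. j < k \<longrightarrow> k < length w \<longrightarrow> \<not> (w ! k < x \<and> x < w ! j))"
proof (induction w)
  case (Cons y w)
  show ?case
    by (auto simp: all_pairs_less_Suc Cons.IH all_set_conv_all_nth)
qed simp

lemma no_ascent_above_iff_nth:
  "no_ascent_above z w \<longleftrightarrow> (\<forall>i j. i < j \<longrightarrow> j < length w \<longrightarrow> \<not> (z < w ! i \<and> w ! i < w ! j))"
proof (induction w)
  case (Cons y w)
  show ?case
    by (auto simp: all_pairs_less_Suc Cons.IH all_set_conv_all_nth)
qed simp

lemma avoids231_iff_nth:
  "avoids231 w \<longleftrightarrow>
     (\<forall>i j k. i < j \<longrightarrow> j < k \<longrightarrow> k < length w \<longrightarrow> \<not> (w ! k < w ! i \<and> w ! i < w ! j))"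
proof (induction w)
  case (Cons x w)
  show ?case (is "_ \<longleftrightarrow> (\<forall>i j k. ?Q i j k)")
  proof
    assume *: "avoids231 (x # w)"
    show "\<forall>i j k. ?Q i j k"
    proof (intro allI impI)
      fix i j k assume "i < j" "j < k" "k < length (x # w)"
      moreover from this obtain j' k' where "j = Suc j'" "k = Suc k'"
        by (metis less_imp_Suc_add)
      ultimately show "\<not> ((x # w) ! k < (x # w) ! i \<and> (x # w) ! i < (x # w) ! j)"
        using * Cons.IH by (cases i) (auto simp: separates_iff_nth)
    qed
  next
    assume *: "\<forall>i j k. ?Q i j k"
    have "separates x w"
      unfolding separates_iff_nth using *[rule_format, of 0 "Suc _" "Suc _"] by auto
    moreover have "avoids231 w"
      unfolding Cons.IH using *[rule_format, of "Suc _" "Suc _" "Suc _"] by auto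
    ultimately show "avoids231 (x # w)" by simp
  qed
qed simp

lemma avoids_iff_avoids231:
  assumes "distinct w"
  shows "avoids w [2, 3, 1] \<longleftrightarrow> avoids231 w"
proof
  assume av: "avoids w [2, 3, 1]"
  show "avoids231 w"
    unfolding avoids231_iff_nth
  proof (intro allI impI notI)
    fix i j k
    assume *: "i < j" "j < k" "k < length w" "w ! k < w ! i \<and> w ! i < w ! j"
    have "contains_pattern w [2, 3, 1]"
      unfolding contains_pattern_def
      using * by (intro exI[of _ "\<lambda>a. [i, j, k] ! a"])
        (auto simp: strict_mono_on_def less_Suc_eq numeral_3_eq_3)
    with av show False by (simp add: avoids_def)
  qed
next
  assume av: "avoids231 w"
  show "avoids w [2, 3, 1]"
    unfolding avoids_def contains_pattern_def
  proof (rule notI, elim exE conjE)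
    fix f :: "nat \<Rightarrow> nat"
    assume mono: "strict_mono_on {..<length [2, 3, 1::nat]} f"
      and len: "\<forall>a<length [2, 3, 1::nat]. f a < length w"
      and pat: "\<forall>a b. a < b \<and> b < length [2, 3, 1::nat] \<longrightarrow>
        (w ! f a < w ! f b \<longleftrightarrow> [2, 3, 1::nat] ! a < [2, 3, 1] ! b)"
    have f: "f 0 < f 1" "f 1 < f 2"
      using mono by (auto simp: strict_mono_on_def)
    have l: "f 2 < length w" using len by simp
    have "w ! f 0 < w ! f 1" "\<not> w ! f 0 < w ! f 2"
      using pat[rule_format, of 0 1] pat[rule_format, of 0 2] by auto
    \<comment> \<open>The failed comparison of 2 with 1 yields only a weak inequality; distinctness
      makes it strict.\<close>
    moreover have "w ! f 0 \<noteq> w ! f 2"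
      using f l assms by (simp add: nth_eq_iff_index_eq)
    ultimately show False
      using av f l unfolding avoids231_iff_nth by (metis linorder_neqE)
  qed
qed

section \<open>Admissible continuations \<open>w\<close> on the missing letters \<open>A\<close>
  after prefix entries \<open>Q\<close>\<close>

definition separated_avoiders :: "'a::linorder set \<Rightarrow> 'a set \<Rightarrow> 'a list set" where
  "separated_avoiders A Q =
     {w \<in> permutations_of_set A. avoids231 w \<and> (\<forall>x\<in>Q. separates x w)}"

lemma finite_separated_avoiders: "finite (separated_avoiders A Q)"
  unfolding separated_avoiders_def by simp

text \<open>The smallest separator \<open>x\<close> forces all of \<open>A\<close> before all of
  \<open>B\<close>, so concatenation is a bijection. The separators in \<open>Q\<close> lie above
  all of \<open>A\<close> and therefore constrain only the \<open>B\<close> part.\<close>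

lemma card_separated_avoiders_insert:
  fixes A B :: "'a::linorder set"
  assumes A: "\<forall>a\<in>A. a < x" and B: "\<forall>b\<in>B. x < b" and Q: "\<forall>q\<in>Q. x < q"
  shows "card (separated_avoiders (A \<union> B) (insert x Q)) =
           card (separated_avoiders A {}) * card (separated_avoiders B Q)"
proof -
  let ?f = "\<lambda>(u, v). u @ v :: 'a list"
  let ?D = "separated_avoiders A {} \<times> separated_avoiders B Q"
  have iff: "avoids231 (u @ v) \<and> (\<forall>q\<in>insert x Q. separates q (u @ v)) \<longleftrightarrow>
      avoids231 u \<and> avoids231 v \<and> (\<forall>q\<in>Q. separates q v)"
    if u: "set u = A" and v: "set v = B" for u v
  proof -
    \<comment> \<open>Every letter of \<open>u\<close> is below every letter of \<open>v\<close>,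
      whereas an occurrence across the cut would need its 1, in \<open>v\<close>, below its 2, in
      \<open>u\<close>.\<close>
    have "\<forall>y\<in>set u. separates y v"
      using A B u v by (auto intro!: separates_upper dest: less_trans)
    moreover have "\<forall>z\<in>set v. no_ascent_above z u"
      using A B u v by (auto intro!: no_ascent_above_lower dest: less_trans)
    moreover have "separates q (u @ v) \<longleftrightarrow> separates q v" if "q \<in> Q" for q
    proof -
      have "\<forall>y\<in>set u. y < q" using A Q u that by (auto dest: less_trans)
      thus ?thesis by (auto simp: separates_append separates_lower dest: less_trans)
    qed
    moreover have "separates x (u @ v)"
      using A B u v separates_lower[of u x] separates_upper[of v x]
      by (auto simp: separates_append dest: order.asym)
    ultimately show ?thesis by (auto simp: avoids231_append)
  qed
  have disj: "A \<inter> B = {}" using A B by force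
  have "inj_on ?f ?D"
  proof (rule inj_onI, clarify)
    fix u v u' v'
    assume "u \<in> separated_avoiders A {}" "u' \<in> separated_avoiders A {}"
      and eq: "u @ v = u' @ v'"
    \<comment> \<open>Both lengths equal the cardinality of \<open>A\<close>, so the two words are
      cut at the same place.\<close>
    hence "length u = length u'"
      by (auto simp: separated_avoiders_def dest!: length_finite_permutations_of_set)
    with eq show "u = u' \<and> v = v'" by simp
  qed
  moreover have "?f ` ?D = separated_avoiders (A \<union> B) (insert x Q)"
  proof (intro equalityI subsetI)
    fix w assume "w \<in> ?f ` ?D"
    then obtain u v where w: "w = u @ v"
      and u: "u \<in> separated_avoiders A {}" and v: "v \<in> separated_avoiders B Q" by auto
    have "set u = A" "set v = B"
      using u v by (auto simp: separated_avoiders_def permutations_of_set_def)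
    with iff[of u v] u v disj show "w \<in> separated_avoiders (A \<union> B) (insert x Q)"
      by (auto simp: w separated_avoiders_def permutations_of_set_def)
  next
    fix w assume w: "w \<in> separated_avoiders (A \<union> B) (insert x Q)"
    define u where "u = filter (\<lambda>y. y < x) w"
    define v where "v = filter (\<lambda>y. x < y) w"
    have set: "set w = A \<union> B" and dist: "distinct w" and sep: "separates x w"
      using w by (auto simp: separated_avoiders_def permutations_of_set_def)
    have "x \<notin> set w" using set A B by auto
    with sep have eq: "w = u @ v"
      unfolding u_def v_def by (rule separates_eq_filter)
    have "set u = A" "set v = B"
      unfolding u_def v_def set_filter set using A B by (auto dest: order.asym)
    moreover have "distinct u" "distinct v"
      using dist by (auto simp: u_def v_def)
    ultimately have "(u, v) \<in> ?D"
      using iff[of u v] w eq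
      by (auto simp: separated_avoiders_def permutations_of_set_def)
    thus "w \<in> ?f ` ?D" using eq by force
  qed
  ultimately show ?thesis
    by (metis card_image card_cartesian_product)
qed

text \<open>Classification by the first letter \<open>x\<close>: the tail avoids 231 and, as
  \<open>x\<close> may play the 2, is separated by \<open>x\<close>.\<close>

lemma card_separated_avoiders_empty:
  assumes "finite S" "S \<noteq> {}"
  shows "card (separated_avoiders S {}) = (\<Sum>x\<in>S. card (separated_avoiders (S - {x}) {x}))"
proof -
  have "separated_avoiders S {} = (\<Union>x\<in>S. (#) x ` separated_avoiders (S - {x}) {x})"
    using permutations_of_set_nonempty[OF assms(2)]
    by (auto simp: separated_avoiders_def)
  also have "card \<dots> = (\<Sum>x\<in>S. card ((#) x ` separated_avoiders (S - {x}) {x}))"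
    using assms by (intro card_UN_disjoint) (auto simp: finite_separated_avoiders)
  also have "\<dots> = (\<Sum>x\<in>S. card (separated_avoiders (S - {x}) {x}))"
    by (simp add: card_image)
  finally show ?thesis .
qed

section \<open>Catalan numbers: recurrence and convolution\<close>

lemma central_binomial_Suc:
  "Suc n * (2 * Suc n choose Suc n) = 2 * (2 * n + 1) * (2 * n choose n)"
proof -
  have "Suc n * (2 * Suc n choose Suc n) = 2 * Suc n * (Suc (2 * n) choose n)"
    using Suc_times_binomial[of n "Suc (2 * n)"]
    by (simp only: mult_2 add_Suc add_Suc_right)
  hence "Suc n * (Suc n * (2 * Suc n choose Suc n)) =
      2 * Suc n * (Suc n * (Suc (2 * n) choose n))"
    by (simp only: mult_ac)
  \<comment> \<open>The complement of \<open>n\<close> in \<open>2 * n + 1\<close> is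
    \<open>Suc n\<close>, so absorption applies a second time.\<close>
  also have "Suc (2 * n) choose n = Suc (2 * n) choose Suc n"
    by (subst binomial_symmetric) auto
  also have "Suc n * \<dots> = Suc (2 * n) * (2 * n choose n)"
    by (rule Suc_times_binomial)
  also have "2 * Suc n * \<dots> = Suc n * (2 * (2 * n + 1) * (2 * n choose n))"
    by simp
  finally show ?thesis by (subst (asm) mult_cancel1) (simp only: nat.distinct simp_thms)
qed

lemma catalan_Suc_mult: "(real n + 2) * catalan (Suc n) = 2 * (2 * real n + 1) * catalan n"
proof -
  have "(real n + 2) * catalan (Suc n) = real (2 * Suc n choose Suc n)"
    unfolding catalan_def by (simp add: field_simps del: binomial_Suc_Suc mult_Suc_right)
  also have "\<dots> = real (Suc n * (2 * Suc n choose Suc n)) / real (Suc n)"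
    unfolding of_nat_mult by (rule nonzero_mult_div_cancel_left [symmetric]) simp
  also have "\<dots> = 2 * (2 * real n + 1) * catalan n"
    unfolding central_binomial_Suc catalan_def by (simp add: algebra_simps)
  finally show ?thesis .
qed

text \<open>These are coefficients of \<open>sqrt (1 - 4 X)\<close>, which equals
  \<open>1 - 2 X C(X)\<close> for the Catalan generating function \<open>C\<close>. Both sides obey
  the same first-order recurrence.\<close>

lemma half_gbinomial_Suc:
  "((1 / 2 :: real) gchoose Suc n) * (-4) ^ Suc n = - 2 * catalan n"
proof (induction n)
  case 0
  show ?case by (simp add: catalan_def)
next
  case (Suc n)
  \<comment> \<open>By the two absorption identities, both sides equal \<open>1/2\<close> times
    \<open>-1/2 gchoose Suc n\<close>.\<close>
  have step: "(real n + 2) * (1 / 2 gchoose Suc (Suc n)) =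
      (1 / 2 - real (Suc n)) * (1 / 2 gchoose Suc n)"
    using gbinomial_absorption[of "Suc n" "1/2::real"] gbinomial_absorb_comp[of "1/2::real" "Suc n"]
    by (simp only: of_nat_Suc) (simp add: add.commute mult.commute)
  have "(real n + 2) * ((1 / 2 gchoose Suc (Suc n)) * (-4) ^ Suc (Suc n)) =
      (real n + 2) * (1 / 2 gchoose Suc (Suc n)) * (-4) ^ Suc (Suc n)"
    by (simp only: mult.assoc)
  also have "\<dots> = - 4 * ((1 / 2 - real (Suc n)) * ((1 / 2 gchoose Suc n) * (-4) ^ Suc n))"
    unfolding step power_Suc[of _ "Suc n"] by (simp only: mult_ac)
  also have "\<dots> = - 2 * ((real n + 2) * catalan (Suc n))"
    unfolding Suc.IH catalan_Suc_mult by (simp add: algebra_simps)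
  also have "\<dots> = (real n + 2) * (- 2 * catalan (Suc n))"
    by (simp only: mult.left_commute)
  finally show ?case by (subst (asm) mult_cancel_left) linarith
qed

text \<open>Vandermonde for \<open>1/2 + 1/2 = 1\<close> is the coefficientwise form of
  \<open>sqrt (1 - 4 X) ^ 2 = 1 - 4 X\<close>.\<close>

lemma catalan_convolution: "(\<Sum>i\<le>n. catalan i * catalan (n - i)) = catalan (Suc n)"
proof -
  define g where "g k = ((1 / 2 :: real) gchoose k) * (-4) ^ k" for k
  have g0: "g 0 = 1" by (simp add: g_def)
  have gS: "g (Suc k) = - 2 * catalan k" for k
    unfolding g_def by (rule half_gbinomial_Suc)
  have "(\<Sum>k\<le>n + 2. g k * g (n + 2 - k)) =
      (\<Sum>k\<le>n + 2. (1 / 2 gchoose k) * (1 / 2 gchoose (n + 2 - k))) * (-4) ^ (n + 2)"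
    unfolding sum_distrib_right
  proof (rule sum.cong[OF refl])
    fix k assume "k \<in> {..n + 2}"
    hence "(-4::real) ^ (n + 2) = (-4) ^ k * (-4) ^ (n + 2 - k)"
      by (simp flip: power_add)
    thus "g k * g (n + 2 - k) =
        (1 / 2 gchoose k) * (1 / 2 gchoose (n + 2 - k)) * (-4) ^ (n + 2)"
      unfolding g_def by simp
  qed
  also have "\<dots> = (real 1 gchoose (n + 2)) * (-4) ^ (n + 2)"
    by (simp only: atMost_atLeast0 gbinomial_Vandermonde field_sum_of_halves of_nat_1)
  \<comment> \<open>The polynomial \<open>1 - 4 X\<close> has no coefficient in degree
    \<open>n + 2\<close>, which is at least 2.\<close>
  also have "\<dots> = 0"
    by (subst binomial_gbinomial [symmetric]) simp
  finally have "0 = (\<Sum>k\<le>n + 2. g k * g (n + 2 - k))" ..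
  \<comment> \<open>Each end term is \<open>- 2 * catalan (Suc n)\<close>, and the middle sum is
    four times the convolution.\<close>
  also have "\<dots> = g 0 * g (n + 2) + (\<Sum>k\<le>n. g (Suc k) * g (n + 1 - k)) + g (n + 2) * g 0"
    unfolding add_2_eq_Suc' sum.atMost_Suc_shift[of _ "Suc n"] by simp
  also have "(\<Sum>k\<le>n. g (Suc k) * g (n + 1 - k)) = (\<Sum>k\<le>n. 4 * (catalan k * catalan (n - k)))"
    by (intro sum.cong) (auto simp: gS Suc_diff_le)
  also have "\<dots> = 4 * (\<Sum>k\<le>n. catalan k * catalan (n - k))"
    by (rule sum_distrib_left [symmetric])
  finally show ?thesis by (simp add: g0 gS)
qed

section \<open>Counting by gaps between the prefix entries\<close>

lemma card_separated_avoiders_interval: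
  fixes a b :: nat
  assumes "a < b"
  shows "real (card (separated_avoiders {a<..<b} {})) = catalan (b - a - 1)"
  using assms
proof (induction "b - a" arbitrary: a b rule: less_induct)
  case less
  show ?case
  proof (cases "b = Suc a")
    case True
    hence "{a<..<b} = {}" by auto
    hence "separated_avoiders {a<..<b} {} = {[]}"
      by (auto simp: separated_avoiders_def)
    with True show ?thesis by (simp add: catalan_def)
  next
    case False
    \<comment> \<open>The interval has \<open>m + 1\<close> letters, so the convolution will run up
      to \<open>m\<close>.\<close>
    with \<open>a < b\<close> obtain m where b: "b = a + 2 + m"
      using le_Suc_ex[of "a + 2" b] by auto
    have "real (card (separated_avoiders {a<..<b} {})) =
        (\<Sum>x\<in>{a<..<b}. real (card (separated_avoiders ({a<..<b} - {x}) {x})))"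
    proof (subst card_separated_avoiders_empty)
      have "Suc a \<in> {a<..<b}" using b by simp
      thus "{a<..<b} \<noteq> {}" by blast
    qed simp_all
    also have "\<dots> = (\<Sum>x\<in>{a<..<b}. catalan (x - a - 1) * catalan (b - x - 1))"
    proof (rule sum.cong[OF refl])
      fix x assume x: "x \<in> {a<..<b}"
      hence "{a<..<b} - {x} = {a<..<x} \<union> {x<..<b}" by auto
      hence "card (separated_avoiders ({a<..<b} - {x}) {x}) =
          card (separated_avoiders {a<..<x} {}) * card (separated_avoiders {x<..<b} {})"
        using card_separated_avoiders_insert[of "{a<..<x}" x "{x<..<b}" "{}"] by simp
      with less.hyps[of x a] less.hyps[of b x] x
      show "real (card (separated_avoiders ({a<..<b} - {x}) {x})) =
          catalan (x - a - 1) * catalan (b - x - 1)" by auto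
    qed
    \<comment> \<open>The new index \<open>i\<close> counts the letters of the interval below the
      first letter \<open>x\<close>.\<close>
    also have "\<dots> = (\<Sum>i\<le>m. catalan i * catalan (m - i))"
      by (rule sum.reindex_bij_witness[of _ "\<lambda>i. a + 1 + i" "\<lambda>x. x - a - 1"])
        (auto simp: b Suc_diff_le intro!: arg_cong2[of _ _ _ _ "(*)"] arg_cong[of _ _ catalan])
    also have "\<dots> = catalan (b - a - 1)"
      by (simp add: catalan_convolution b)
    finally show ?thesis .
  qed
qed

text \<open>Removing the smallest entry of \<open>xs\<close> splits off the lowest gap as an
  independent factor; the entry then becomes the left border of the rest.\<close>

lemma card_separated_avoiders_gaps:
  fixes a b :: nat
  assumes "sorted_wrt (<) (a # xs @ [b])"
  shows "real (card (separated_avoiders ({a<..<b} - set xs) (set xs))) =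
    (\<Prod>k = 1..length xs + 1.
       catalan ((a # xs @ [b]) ! k - (a # xs @ [b]) ! (k - 1) - 1))"
  using assms
proof (induction xs arbitrary: a)
  case Nil
  thus ?case by (simp add: card_separated_avoiders_interval)
next
  case (Cons x xs)
  let ?l = "x # xs @ [b]"
  have x: "a < x" "x < b" and xs: "\<forall>y\<in>set xs. x < y" using Cons.prems by auto
  have "{a<..<b} - set (x # xs) = {a<..<x} \<union> ({x<..<b} - set xs)"
    using x xs by (auto dest: less_trans)
  hence "card (separated_avoiders ({a<..<b} - set (x # xs)) (set (x # xs))) =
      card (separated_avoiders {a<..<x} {}) * card (separated_avoiders ({x<..<b} - set xs) (set xs))"
    using xs by (simp add: card_separated_avoiders_insert)
  hence "real (card (separated_avoiders ({a<..<b} - set (x # xs)) (set (x # xs)))) =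
      catalan (x - a - 1) * (\<Prod>k = 1..length xs + 1. catalan (?l ! k - ?l ! (k - 1) - 1))"
    using Cons x by (simp add: card_separated_avoiders_interval)
  also have "(\<Prod>k = 1..length xs + 1. catalan (?l ! k - ?l ! (k - 1) - 1)) =
      (\<Prod>k = 2..length xs + 2. catalan ((a # ?l) ! k - (a # ?l) ! (k - 1) - 1))"
    by (rule prod.reindex_bij_witness[of _ "\<lambda>k. k - 1" Suc]) (auto simp: nth_Cons split: nat.splits)
  also have "catalan (x - a - 1) * \<dots> =
      (\<Prod>k = 1..length xs + 2. catalan ((a # ?l) ! k - (a # ?l) ! (k - 1) - 1))"
    by (subst (2) prod.atLeast_Suc_atMost) (auto simp: numeral_2_eq_2)
  finally show ?case by simp
qed

text \<open>The condition cutting an occurrence after its 3 depends only on \<open>cs\<close> and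
  the set of missing letters, not on their order, so it rejects either every continuation or
  none.\<close>

lemma prefix_avoiders_231:
  assumes "distinct cs" "set cs \<subseteq> {1..n}" "avoids cs [2, 3, 1]"
  shows "prefix_avoiders n cs {[2, 3, 1]} =
    (if \<forall>z\<in>{1..n} - set cs. no_ascent_above z cs
     then (@) cs ` separated_avoiders ({1..n} - set cs) (set cs) else {})"
proof -
  have av: "avoids231 cs" using assms(3) unfolding avoids_iff_avoids231[OF assms(1)] .
  have "\<tau> \<in> prefix_avoiders n cs {[2, 3, 1]} \<longleftrightarrow>
      (\<exists>w. \<tau> = cs @ w \<and> w \<in> separated_avoiders ({1..n} - set cs) (set cs) \<and>
        (\<forall>z\<in>{1..n} - set cs. no_ascent_above z cs))" for \<tau>
  proof -
    have "\<tau> \<in> prefix_avoiders n cs {[2, 3, 1]} \<longleftrightarrow>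
        (\<exists>w. \<tau> = cs @ w \<and> set \<tau> = {1..n} \<and> distinct \<tau> \<and> avoids231 \<tau>)"
      unfolding prefix_avoiders_def prefix_def permutations_of_set_def
      using avoids_iff_avoids231[of \<tau>] by blast
    also have "\<dots> \<longleftrightarrow> (\<exists>w. \<tau> = cs @ w \<and> set w = {1..n} - set cs \<and> distinct w \<and> avoids231 \<tau>)"
      using assms by auto
    also have "\<dots> \<longleftrightarrow> (\<exists>w. \<tau> = cs @ w \<and> w \<in> separated_avoiders ({1..n} - set cs) (set cs) \<and>
        (\<forall>z\<in>{1..n} - set cs. no_ascent_above z cs))"
      using av by (auto simp: avoids231_append separated_avoiders_def permutations_of_set_def)
    finally show ?thesis .
  qed
  thus ?thesis by auto
qed

theorem theorem4p1:
  fixes n t :: nat and cs :: "nat list"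
  assumes "n \<ge> 3" and "1 \<le> t" and "t < n"
    and "length cs = t" and "distinct cs" and "set cs \<subseteq> {1..n}"
    and "avoids cs [2, 3, 1]"
  shows "if \<exists>i j. i < j \<and> j < t \<and> cs ! i < cs ! j \<and>
               (\<exists>\<alpha>\<in>{1..n}. \<alpha> < cs ! i \<and> \<alpha> \<notin> set cs)
         then card (prefix_avoiders n cs {[2, 3, 1]}) = 0
         else real (card (prefix_avoiders n cs {[2, 3, 1]})) =
              (\<Prod>k = 1..t + 1.
                 catalan (bordered_sort n cs ! k - bordered_sort n cs ! (k - 1) - 1))"
proof -
  let ?xs = "sorted_list_of_set (set cs)"
  have cond: "(\<exists>i j. i < j \<and> j < t \<and> cs ! i < cs ! j \<and>
               (\<exists>\<alpha>\<in>{1..n}. \<alpha> < cs ! i \<and> \<alpha> \<notin> set cs)) \<longleftrightarrow>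
      \<not> (\<forall>z\<in>{1..n} - set cs. no_ascent_above z cs)"
    unfolding no_ascent_above_iff_nth \<open>length cs = t\<close> by blast
  have sorted: "sorted_wrt (<) (0 # ?xs @ [n + 1])"
    using \<open>set cs \<subseteq> {1..n}\<close> by (auto simp: sorted_wrt_append)
  \<comment> \<open>As an open interval, the range has the artificial entries \<open>0\<close> and
    \<open>n + 1\<close> as its borders.\<close>
  have "{1..n} = {0<..<n + 1}" by auto
  hence "real (card (separated_avoiders ({1..n} - set cs) (set cs))) =
      (\<Prod>k = 1..t + 1. catalan (bordered_sort n cs ! k - bordered_sort n cs ! (k - 1) - 1))"
    using card_separated_avoiders_gaps[OF sorted] assms
    by (simp add: bordered_sort_def distinct_card)
  moreover have "card ((@) cs ` W) = card W" for W
    by (rule card_image) (simp add: inj_on_def)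
  ultimately show ?thesis
    unfolding cond prefix_avoiders_231[OF assms(5-7)] by auto
qed

end
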